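(* Let $(e_n)_{n=1}^\infty$ be an orthonormal basis for an infinite-dimensional real Hilbert space $\mathcal{H}$. For each $m\in\mathbb{N}$ let $V_m=\mathrm{span}\{e_1,\dots,e_m\}$ and let $P_m:\mathcal{H}\to V_m$ be the orthogonal projection. Fix $0<\varepsilon<8^{-1}$, let $(\alpha_n)_{n=1}^\infty$ be a sequence decreasing to $0$ with $\sum_{n=2}^\infty\alpha_n<\varepsilon/2$, and let $(\beta_n)_{n=1}^\infty$ be a sequence decreasing to $0$ with $\beta_n<2^{-1}\alpha_n$ for all $n\in\mathbb{N}$. Define $$\mathcal{B}=\{f\in\mathcal{H}:\ \|f-P_mf\|\leq\beta_{m+1}\|f\|\ \text{ for every } m\in\mathbb{N}\}$$ and consider the Riesz basis $\Phi=(\varphi_n)_{n=1}^\infty$ of $\mathcal{H}$ given by $\varphi_1=e_1$ and $\varphi_n=\alpha_ne_1+e_n$ for all $n\geq2$. Then for all $f,g\in\mathcal{B}$ we have $$\inf_{|\alpha|=1}\|f-\alpha g\|\leq(1-\varepsilon)^{-1/2}\|\mathcal{A}_\Phi(f)-\mathcal{A}_\Phi(g)\|.$$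
   Context: $\mathcal{A}_\Phi(f)=(|\langle f,\varphi_n\rangle|)_{n}\in\ell_2$, and $\|\mathcal{A}_\Phi(f)-\mathcal{A}_\Phi(g)\|$ is the $\ell_2$ norm. The infimum is over real scalars $\alpha$ with $|\alpha|=1$, i.e. $\alpha=\pm1$. *)

theory Defs
  imports "HOL-Analysis.Analysis"
begin

text \<open>
  A real Hilbert space is a type of sort \<open>{real_inner, complete_space}\<close>. A sequence
  indexed by \<open>n = 1, 2, 3, \<dots>\<close> is a function on \<^typ>\<open>nat\<close> of which only the values on
  \<open>{1..}\<close> are used.
\<close>

definition orthonormal_basis :: "(nat \<Rightarrow> 'a::{real_inner,complete_space}) \<Rightarrow> bool"
  where "orthonormal_basis e \<longleftrightarrow>
    (\<forall>m\<ge>1. \<forall>n\<ge>1. e m \<bullet> e n = (if m = n then 1 else 0)) \<and>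
    closure (span (e ` {1..})) = UNIV"

text \<open>A Riesz basis is the image of an orthonormal basis under a bounded invertible operator.\<close>

definition riesz_basis :: "(nat \<Rightarrow> 'a::{real_inner,complete_space}) \<Rightarrow> bool"
  where "riesz_basis \<Phi> \<longleftrightarrow>
    (\<exists>(e :: nat \<Rightarrow> 'a) T. orthonormal_basis e \<and>
           bounded_linear T \<and> bij T \<and> bounded_linear (inv T) \<and>
           (\<forall>n\<ge>1. \<Phi> n = T (e n)))"

text \<open>
  The orthogonal projection onto \<open>S\<close>. The description is proper whenever \<open>S\<close> is a closed
  subspace; for the spans used here see \<open>orth_proj_span\<close> below.
\<close>

definition orth_proj :: "'a::{real_inner,complete_space} set \<Rightarrow> 'a \<Rightarrow> 'a"
  where "orth_proj S x = (THE y. y \<in> S \<and> x - y \<in> S\<^sup>\<bottom>)"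

definition ell2 :: "(nat \<Rightarrow> real) set"
  where "ell2 = {x. (\<lambda>n. (x n)\<^sup>2) summable_on {1..}}"

definition ell2_norm :: "(nat \<Rightarrow> real) \<Rightarrow> real"
  where "ell2_norm x = sqrt (\<Sum>\<^sub>\<infinity>n\<in>{1..}. (x n)\<^sup>2)"

definition amplitude :: "(nat \<Rightarrow> 'a::{real_inner,complete_space}) \<Rightarrow> 'a \<Rightarrow> nat \<Rightarrow> real"
  where "amplitude \<Phi> f = (\<lambda>n. \<bar>f \<bullet> \<Phi> n\<bar>)"

lemma orth_proj_unique:
  assumes S: "subspace S" and y: "y \<in> S" "x - y \<in> S\<^sup>\<bottom>"
  shows "orth_proj S x = y"
  unfolding orth_proj_def
proof (rule the_equality)
  show "y \<in> S \<and> x - y \<in> S\<^sup>\<bottom>" using y by simp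
next
  fix z assume z: "z \<in> S \<and> x - z \<in> S\<^sup>\<bottom>"
  have d: "z - y \<in> S" using S y z by (simp add: subspace_diff)
  have "(z - y) \<bullet> (x - y) = 0" "(z - y) \<bullet> (x - z) = 0"
    using d y z by (auto simp: orthogonal_comp_def orthogonal_def)
  then have "(z - y) \<bullet> (z - y) = 0" by (simp add: inner_diff_right)
  then show "z = y" by simp
qed

lemma orth_proj_span:
  assumes "orthonormal_basis e"
  shows "orth_proj (span (e ` {1..m})) f = (\<Sum>i=1..m. (f \<bullet> e i) *\<^sub>R e i)"
proof (rule orth_proj_unique)
  let ?p = "\<Sum>i=1..m. (f \<bullet> e i) *\<^sub>R e i"
  show "subspace (span (e ` {1..m}))" by simp
  show "?p \<in> span (e ` {1..m})"
    by (intro span_sum span_scale span_base) auto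
  have "orthogonal (f - ?p) y" if "y \<in> span (e ` {1..m})" for y
    using that
  proof (rule orthogonal_to_span)
    fix z assume "z \<in> e ` {1..m}"
    then obtain j where j: "j \<in> {1..m}" "z = e j" by auto
    have "?p \<bullet> e j = (\<Sum>i=1..m. if i = j then f \<bullet> e i else 0)"
      unfolding inner_sum_left
      by (rule sum.cong) (use assms j in \<open>auto simp: orthonormal_basis_def\<close>)
    also have "\<dots> = f \<bullet> e j" using j by simp
    finally show "orthogonal (f - ?p) z" using j by (simp add: orthogonal_def inner_diff_left)
  qed
  then show "f - ?p \<in> (span (e ` {1..m}))\<^sup>\<bottom>"
    by (auto simp: orthogonal_comp_def orthogonal_commute)
qed

lemma amplitude_in_ell2:
  fixes \<Phi> :: "nat \<Rightarrow> 'a::{real_inner,complete_space}"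
  assumes "riesz_basis \<Phi>"
  shows "amplitude \<Phi> f \<in> ell2"
proof -
  obtain e :: "nat \<Rightarrow> 'a" and T where e: "orthonormal_basis e" and T: "bounded_linear T"
    and \<Phi>: "\<And>n. n \<ge> 1 \<Longrightarrow> \<Phi> n = T (e n)"
    using assms unfolding riesz_basis_def by blast
  obtain K where K: "K \<ge> 0" "\<And>x. norm (T x) \<le> norm x * K"
    using bounded_linear.nonneg_bounded[OF T] by blast
  have bound: "(\<Sum>n\<in>F. (f \<bullet> \<Phi> n)\<^sup>2) \<le> (norm f * K)\<^sup>2" if F: "finite F" "F \<subseteq> {1..}" for F
  proof -
    define c where "c = (\<lambda>n. f \<bullet> \<Phi> n)"
    define s where "s = (\<Sum>n\<in>F. c n *\<^sub>R e n)"
    define q where "q = (\<Sum>n\<in>F. (c n)\<^sup>2)"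
    have "s \<bullet> s = (\<Sum>n\<in>F. \<Sum>m\<in>F. c n * (c m * (e n \<bullet> e m)))"
      by (simp add: s_def inner_sum_left inner_sum_right sum_distrib_left inner_commute mult.left_commute)
    also have "\<dots> = (\<Sum>n\<in>F. \<Sum>m\<in>F. if n = m then c n * c m else 0)"
      by (intro sum.cong refl) (use e F in \<open>auto simp: orthonormal_basis_def subset_iff\<close>)
    also have "\<dots> = q" using F by (simp add: q_def power2_eq_square)
    finally have s: "(norm s)\<^sup>2 = q" by (simp add: power2_norm_eq_inner)
    have Ts: "T s = (\<Sum>n\<in>F. c n *\<^sub>R \<Phi> n)"
      unfolding s_def
      using F \<Phi> bounded_linear.linear[OF T]
      by (auto simp: linear_sum linear_scale subset_iff intro!: sum.cong)
    have "q = f \<bullet> T s"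
      by (simp add: Ts q_def inner_sum_right c_def power2_eq_square)
    also have "\<dots> \<le> norm f * norm (T s)" by (rule norm_cauchy_schwarz)
    also have "\<dots> \<le> norm f * (norm s * K)" by (rule mult_left_mono[OF K(2)]) simp
    finally have "(norm s) * (norm s) \<le> norm s * (norm f * K)"
      using s by (simp add: power2_eq_square ac_simps)
    then have "norm s \<le> norm f * K"
      using K by (cases "norm s = 0") (auto simp: mult_le_cancel_left)
    then have "(norm s)\<^sup>2 \<le> (norm f * K)\<^sup>2" by (rule power_mono) simp
    then show ?thesis using s by (simp add: q_def c_def)
  qed
  have "(\<lambda>n. (f \<bullet> \<Phi> n)\<^sup>2) summable_on {1..}"
    by (rule nonneg_bdd_above_summable_on) (use bound in \<open>auto intro!: bdd_aboveI2[where M = "(norm f * K)\<^sup>2"]\<close>)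
  then show ?thesis by (simp add: ell2_def amplitude_def)
qed

lemma ell2_diff:
  assumes "x \<in> ell2" "y \<in> ell2"
  shows "(\<lambda>n. x n - y n) \<in> ell2"
proof -
  have "(\<lambda>n. 2 * (x n)\<^sup>2 + 2 * (y n)\<^sup>2) summable_on {1..}"
    using assms by (intro summable_on_add summable_on_cmult_right) (auto simp: ell2_def)
  moreover have "(x n - y n)\<^sup>2 \<le> 2 * (x n)\<^sup>2 + 2 * (y n)\<^sup>2" for n
    using sum_squares_bound[of "x n" "- y n"] by (simp add: power2_diff)
  ultimately have "(\<lambda>n. (x n - y n)\<^sup>2) summable_on {1..}"
    by (rule summable_on_comparison_test) simp_all
  then show ?thesis by (simp add: ell2_def)
qed

end

theory Submission
  imports Defs
begin

text \<open>
  For \<open>f \<in> \<B>\<close> the first coordinate carries at least half of the norm of \<open>f\<close>, while the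
  \<open>n\<close>-th coordinate is at most \<open>\<beta>\<^sub>n \<parallel>f\<parallel> \<le> \<alpha>\<^sub>n \<parallel>f\<parallel> / 2\<close>. Hence the perturbation \<open>\<alpha>\<^sub>n e\<^sub>1\<close>
  forces all the numbers \<open>\<langle>f, \<phi>\<^sub>n\<rangle>\<close> to have the sign of \<open>\<langle>f, e\<^sub>1\<rangle>\<close>. After changing the signs
  of \<open>f\<close> and \<open>g\<close> the absolute values can be dropped, and what remains is the lower Riesz bound
  \<open>(1 - 2 \<Sum>\<alpha>\<^sub>n) \<parallel>h\<parallel>\<^sup>2 \<le> \<Sum> \<langle>h, \<phi>\<^sub>n\<rangle>\<^sup>2\<close> for \<open>h = f - g\<close>.
\<close>

lemma orthonormal_basis_inner:
  assumes "orthonormal_basis e" "m \<ge> 1" "n \<ge> 1"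
  shows "e m \<bullet> e n = (if m = n then 1 else 0)"
  using assms by (simp add: orthonormal_basis_def)

lemma orthonormal_basis_norm:
  assumes "orthonormal_basis e" "n \<ge> 1"
  shows "norm (e n) = 1"
  using orthonormal_basis_inner[OF assms(1) assms(2) assms(2)] by (simp add: norm_eq_1)

lemma inner_partial_sum:
  assumes e: "orthonormal_basis e" and j: "j \<ge> 1"
  shows "(\<Sum>i=1..m. c i *\<^sub>R e i) \<bullet> e j = (if j \<le> m then c j else 0)"
proof -
  have "(\<Sum>i=1..m. c i *\<^sub>R e i) \<bullet> e j = (\<Sum>i=1..m. if i = j then c i else 0)"
    unfolding inner_sum_left
    by (rule sum.cong) (use orthonormal_basis_inner[OF e _ j] in auto)
  then show ?thesis using j by simp
qed

text \<open>An approximate Parseval identity with finite sums only. Density gives a point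
  \<open>y\<close> of some finite span within \<open>sqrt d\<close> of \<open>x\<close>; the partial
  expansion \<open>p\<close> is the point of that span nearest to \<open>x\<close>, and the squared
  norm of \<open>x - p\<close> is exactly what the coefficients in \<open>p\<close> miss.\<close>

lemma sum_coefficients_approx:
  fixes e :: "nat \<Rightarrow> 'a::{real_inner,complete_space}"
  assumes e: "orthonormal_basis e" and d: "d > 0"
  shows "\<exists>m. (norm x)\<^sup>2 - d \<le> (\<Sum>i=1..m. (x \<bullet> e i)\<^sup>2)"
proof -
  have "x \<in> closure (span (e ` {1..}))" using e by (simp add: orthonormal_basis_def)
  then obtain y where y: "y \<in> span (e ` {1..})" "dist y x < sqrt d"
    using d by (meson closure_approachable real_sqrt_gt_zero)
  obtain S where S: "finite S" "S \<subseteq> e ` {1..}" "y \<in> span S"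
    using y(1) span_explicit[of "e ` {1..}"] by (auto intro: span_sum span_scale span_base)
  obtain N where N: "N \<subseteq> {1..}" "finite N" "S = e ` N"
    using finite_subset_image[OF S(1,2)] by blast
  obtain m where m: "N \<subseteq> {1..m}"
    using N finite_nat_set_iff_bounded_le[of N] by (meson atLeastAtMost_iff atLeast_iff subset_iff)
  define p where "p = (\<Sum>i=1..m. (x \<bullet> e i) *\<^sub>R e i)"
  have y': "y \<in> span (e ` {1..m})" using S(3) N(3) m span_mono by (meson image_mono subsetD)
  have p: "p \<in> span (e ` {1..m})" unfolding p_def by (intro span_sum span_scale span_base) auto
  have orth: "orthogonal (x - p) z" if "z \<in> span (e ` {1..m})" for z
    using that
  proof (rule orthogonal_to_span)
    fix z assume "z \<in> e ` {1..m}"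
    then obtain j where j: "1 \<le> j" "j \<le> m" "z = e j" by auto
    show "orthogonal (x - p) z"
      using inner_partial_sum[OF e j(1), of "\<lambda>i. x \<bullet> e i" m] j
      by (simp add: orthogonal_def inner_diff_left p_def)
  qed
  \<comment> \<open>Both \<open>p\<close> and \<open>y\<close> lie in the span and
    \<open>x - p\<close> is orthogonal to it, so Pythagoras shows that \<open>p\<close> approximates
    \<open>x\<close> at least as well as \<open>y\<close> does.\<close>
  have "(norm (x - y))\<^sup>2 = (norm (x - p))\<^sup>2 + (norm (p - y))\<^sup>2"
    using norm_add_Pythagorean[OF orth[OF span_diff[OF p y']]] by simp
  moreover have "(norm (x - y))\<^sup>2 \<le> d"
    using y(2) d power_mono[of "norm (x - y)" "sqrt d" 2] by (simp add: dist_norm norm_minus_commute)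
  ultimately have "(norm (x - p))\<^sup>2 \<le> d" using zero_le_power2[of "norm (p - y)"] by linarith
  moreover have "(norm x)\<^sup>2 = (norm (x - p))\<^sup>2 + (norm p)\<^sup>2"
    using norm_add_Pythagorean[OF orth[OF p]] by simp
  moreover have "(norm p)\<^sup>2 = (\<Sum>i=1..m. (x \<bullet> e i)\<^sup>2)"
  proof -
    have "p \<bullet> p = (\<Sum>i=1..m. (x \<bullet> e i) * (p \<bullet> e i))"
      by (subst (2) p_def) (simp add: inner_sum_right)
    also have "\<dots> = (\<Sum>i=1..m. (x \<bullet> e i)\<^sup>2)"
      unfolding p_def by (rule sum.cong) (use inner_partial_sum[OF e] in \<open>auto simp: power2_eq_square\<close>)
    finally show ?thesis by (simp add: power2_norm_eq_inner)
  qed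
  ultimately show ?thesis by (intro exI[of _ m]) linarith
qed

text \<open>Since the \<open>e n\<close> are unit vectors, the triangle inequality bounds
  differences of the vector partial sums \<open>S\<close> by those of the scalar partial sums
  \<open>R\<close>; completeness then gives the limit \<open>v\<close>.\<close>

lemma ex_vector_with_coefficients:
  fixes e :: "nat \<Rightarrow> 'a::{real_inner,complete_space}"
  assumes e: "orthonormal_basis e" and a: "\<And>n. n \<ge> 1 \<Longrightarrow> 0 \<le> a n" and s: "a summable_on {1..}"
  shows "\<exists>v. \<forall>n\<ge>1. v \<bullet> e n = a n"
proof -
  define R where "R m = (\<Sum>i=1..m. a i)" for m
  define S where "S m = (\<Sum>i=1..m. a i *\<^sub>R e i)" for m
  have Rinc: "incseq R"
    unfolding R_def by (rule incseq_SucI) (simp add: a)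
  have Rle: "R m \<le> (\<Sum>\<^sub>\<infinity>n\<in>{1..}. a n)" for m
    unfolding R_def by (rule finite_sum_le_infsum[OF s]) (auto simp: a)
  have "Cauchy R"
    using incseq_convergent[OF Rinc, of "\<Sum>\<^sub>\<infinity>n\<in>{1..}. a n"] Rle
    by (meson LIMSEQ_imp_Cauchy)
  have step: "norm (S n - S m) \<le> R n - R m" if "m \<le> n" for m n
    using that
  proof (induction n rule: dec_induct)
    case (step n)
    have "norm (S (Suc n) - S m) = norm ((S n - S m) + a (Suc n) *\<^sub>R e (Suc n))"
      by (simp add: S_def algebra_simps)
    also have "\<dots> \<le> norm (S n - S m) + a (Suc n)"
      using norm_triangle_ineq[of "S n - S m" "a (Suc n) *\<^sub>R e (Suc n)"]
        orthonormal_basis_norm[OF e, of "Suc n"] a[of "Suc n"] by simp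
    also have "\<dots> \<le> R (Suc n) - R m" using step.IH by (simp add: R_def)
    finally show ?case .
  qed simp
  have le: "dist (S m) (S n) \<le> dist (R m) (R n)" for m n
    using step[of m n] step[of n m]
    by (cases "m \<le> n") (auto simp: dist_norm norm_minus_commute abs_minus_commute)
  have "Cauchy S"
    using \<open>Cauchy R\<close> le unfolding Cauchy_def by (meson le_less_trans)
  then obtain v where v: "S \<longlonglongrightarrow> v" using Cauchy_convergent convergent_def by blast
  have "v \<bullet> e n = a n" if n: "n \<ge> 1" for n
  proof (rule LIMSEQ_unique)
    show "(\<lambda>m. S m \<bullet> e n) \<longlonglongrightarrow> v \<bullet> e n" by (intro tendsto_inner v tendsto_const)
    have "eventually (\<lambda>m. S m \<bullet> e n = a n) sequentially"
      using eventually_ge_at_top[of n]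
      by eventually_elim (use inner_partial_sum[OF e n] in \<open>simp add: S_def\<close>)
    then show "(\<lambda>m. S m \<bullet> e n) \<longlonglongrightarrow> a n" by (rule tendsto_eventually)
  qed
  then show ?thesis by blast
qed

text \<open>
  With \<open>v = \<Sum>\<^sub>n\<^sub>\<ge>\<^sub>2 \<alpha>\<^sub>n e\<^sub>n\<close> the operator \<open>x \<mapsto> x + \<langle>x, v\<rangle> e\<^sub>1\<close> maps \<open>e\<^sub>n\<close> to \<open>\<phi>\<^sub>n\<close>; since
  \<open>v \<bottom> e\<^sub>1\<close>, its inverse is \<open>x \<mapsto> x - \<langle>x, v\<rangle> e\<^sub>1\<close>.
\<close>

lemma riesz_basis_perturbation:
  fixes e \<Phi> :: "nat \<Rightarrow> 'a::{real_inner,complete_space}"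
  assumes e: "orthonormal_basis e"
    and a: "\<And>n. n \<ge> 2 \<Longrightarrow> 0 \<le> a n" and s: "a summable_on {2..}"
    and \<Phi>: "\<Phi> 1 = e 1" "\<And>n. n \<ge> 2 \<Longrightarrow> \<Phi> n = a n *\<^sub>R e 1 + e n"
  shows "riesz_basis \<Phi>"
proof -
  \<comment> \<open>The value 0 at index 1 makes \<open>v\<close> orthogonal to \<open>e 1\<close>,
    so adding a multiple of \<open>e 1\<close> does not change the inner product with
    \<open>v\<close>.\<close>
  define b where "b n = (if n \<ge> 2 then a n else 0)" for n
  have "b summable_on {1..}"
    using s by (rule summable_on_cong_neutral[THEN iffD1, rotated -1]) (auto simp: b_def)
  then obtain v where v: "\<And>n. n \<ge> 1 \<Longrightarrow> v \<bullet> e n = b n"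
    using ex_vector_with_coefficients[OF e, of b] a by (metis b_def order_refl)
  define T where "T x = x + (x \<bullet> v) *\<^sub>R e 1" for x
  define U where "U x = x - (x \<bullet> v) *\<^sub>R e 1" for x
  have v1: "e 1 \<bullet> v = 0" using v[of 1] by (simp add: b_def inner_commute)
  have TU: "T (U x) = x" "U (T x) = x" for x
    using v1 by (simp_all add: T_def U_def inner_diff_left inner_add_left)
  have bl: "bounded_linear (\<lambda>x. (x \<bullet> v) *\<^sub>R e 1)"
    by (intro bounded_linear_scaleR_const bounded_linear_inner_left)
  have "bounded_linear T" "bounded_linear U"
    unfolding T_def[abs_def] U_def[abs_def]
    by (intro bounded_linear_add bounded_linear_sub bounded_linear_ident bl)+
  moreover have "bij T" using TU by (metis bijI')
  moreover have "inv T = U" using TU by (metis ext inv_equality)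
  moreover have "\<Phi> n = T (e n)" if "n \<ge> 1" for n
    using v[OF that] \<Phi>(1) \<Phi>(2)[of n] that v1
    by (cases "n = 1") (auto simp: T_def b_def inner_commute)
  ultimately show ?thesis unfolding riesz_basis_def using e by metis
qed

text \<open>Expand the square of \<open>h \<bullet> \<Phi> n\<close>: the term with the square of
  \<open>a n\<close> is nonnegative and is dropped, and by Cauchy-Schwarz the cross term costs at
  most \<open>2 * a n\<close> times the squared norm of \<open>h\<close>. Summing and using Parseval
  up to a slack \<open>d\<close> gives the bound.\<close>

lemma riesz_lower_bound:
  fixes e \<Phi> :: "nat \<Rightarrow> 'a::{real_inner,complete_space}"
  assumes e: "orthonormal_basis e"
    and a: "\<And>n. n \<ge> 2 \<Longrightarrow> 0 \<le> a n" and s: "a summable_on {2..}"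
    and \<Phi>: "\<Phi> 1 = e 1" "\<And>n. n \<ge> 2 \<Longrightarrow> \<Phi> n = a n *\<^sub>R e 1 + e n"
    and h: "(\<lambda>n. (h \<bullet> \<Phi> n)\<^sup>2) summable_on {1..}"
  shows "(1 - 2 * (\<Sum>\<^sub>\<infinity>n\<in>{2..}. a n)) * (norm h)\<^sup>2 \<le> (\<Sum>\<^sub>\<infinity>n\<in>{1..}. (h \<bullet> \<Phi> n)\<^sup>2)"
proof (rule field_le_epsilon)
  fix d :: real assume "d > 0"
  then obtain m where m: "(norm h)\<^sup>2 - d \<le> (\<Sum>i=1..m. (h \<bullet> e i)\<^sup>2)"
    using sum_coefficients_approx[OF e] by blast
  \<comment> \<open>Extending by 0 at index 1 gives \<open>\<Phi> 1 = e 1\<close>, which is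
    unperturbed, the same form of estimate as the other terms.\<close>
  define b where "b n = (if n \<ge> 2 then a n else 0)" for n
  have coef: "\<bar>h \<bullet> e n\<bar> \<le> norm h" if "n \<ge> 1" for n
    using Cauchy_Schwarz_ineq2[of h "e n"] orthonormal_basis_norm[OF e that] by simp
  have termwise: "(h \<bullet> e n)\<^sup>2 - 2 * (norm h)\<^sup>2 * b n \<le> (h \<bullet> \<Phi> n)\<^sup>2" if n: "n \<ge> 1" for n
  proof (cases "n = 1")
    case False
    then have n2: "n \<ge> 2" using n by simp
    have "\<bar>(h \<bullet> e 1) * (h \<bullet> e n)\<bar> \<le> (norm h)\<^sup>2"
      unfolding abs_mult power2_eq_square using coef[of 1] coef[OF n] by (intro mult_mono) auto
    then have "a n * (- (norm h)\<^sup>2) \<le> a n * ((h \<bullet> e 1) * (h \<bullet> e n))"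
      using a[OF n2] by (intro mult_left_mono) auto
    moreover have "(h \<bullet> \<Phi> n)\<^sup>2
        = (h \<bullet> e n)\<^sup>2 + 2 * (a n * ((h \<bullet> e 1) * (h \<bullet> e n))) + (a n * (h \<bullet> e 1))\<^sup>2"
      using \<Phi>(2)[OF n2] by (simp add: inner_add_right power2_eq_square algebra_simps)
    moreover have "2 * (norm h)\<^sup>2 * b n = - 2 * (a n * (- (norm h)\<^sup>2))" using n2 by (simp add: b_def)
    ultimately show ?thesis using zero_le_power2[of "a n * (h \<bullet> e 1)"] by linarith
  qed (use \<Phi>(1) in \<open>simp add: b_def\<close>)
  have "(\<Sum>i=1..m. b i) = (\<Sum>i=2..m. a i)"
    by (rule sum.mono_neutral_cong_right) (auto simp: b_def)
  also have "\<dots> \<le> (\<Sum>\<^sub>\<infinity>n\<in>{2..}. a n)"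
    by (rule finite_sum_le_infsum[OF s]) (auto simp: a)
  finally have "2 * (norm h)\<^sup>2 * (\<Sum>i=1..m. b i) \<le> 2 * (norm h)\<^sup>2 * (\<Sum>\<^sub>\<infinity>n\<in>{2..}. a n)"
    by (intro mult_left_mono) auto
  moreover have "(\<Sum>i=1..m. (h \<bullet> e i)\<^sup>2) - 2 * (norm h)\<^sup>2 * (\<Sum>i=1..m. b i) \<le> (\<Sum>i=1..m. (h \<bullet> \<Phi> i)\<^sup>2)"
    unfolding sum_distrib_left sum_subtractf[symmetric] by (rule sum_mono) (use termwise in auto)
  moreover have "(\<Sum>i=1..m. (h \<bullet> \<Phi> i)\<^sup>2) \<le> (\<Sum>\<^sub>\<infinity>n\<in>{1..}. (h \<bullet> \<Phi> n)\<^sup>2)"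
    by (rule finite_sum_le_infsum[OF h]) auto
  ultimately show "(1 - 2 * (\<Sum>\<^sub>\<infinity>n\<in>{2..}. a n)) * (norm h)\<^sup>2
      \<le> (\<Sum>\<^sub>\<infinity>n\<in>{1..}. (h \<bullet> \<Phi> n)\<^sup>2) + d"
    using m by (simp add: algebra_simps)
qed

text \<open>The two halves match: \<open>b 2 \<le> 1/2\<close> leaves \<open>f \<bullet> e 1\<close>
  at least half of \<open>norm f\<close>, so \<open>a n * (f \<bullet> e 1)\<close> dominates
  \<open>a n / 2 * norm f\<close>, which in turn bounds the modulus of
  \<open>f \<bullet> e n\<close>.\<close>

lemma inner_nonneg_of_decay:
  fixes e \<Phi> :: "nat \<Rightarrow> 'a::{real_inner,complete_space}"
  assumes e: "orthonormal_basis e"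
    and f: "\<And>m. m \<ge> 1 \<Longrightarrow>
      norm (f - orth_proj (span (e ` {1..m})) f) \<le> b (m + 1) * norm f"
    and b: "b 2 \<le> 1/2" "\<And>n. n \<ge> 2 \<Longrightarrow> b n \<le> a n / 2" and a: "\<And>n. n \<ge> 2 \<Longrightarrow> 0 \<le> a n"
    and \<Phi>: "\<Phi> 1 = e 1" "\<And>n. n \<ge> 2 \<Longrightarrow> \<Phi> n = a n *\<^sub>R e 1 + e n"
    and f1: "f \<bullet> e 1 \<ge> 0" and n: "n \<ge> 1"
  shows "f \<bullet> \<Phi> n \<ge> 0"
proof (cases "n = 1")
  case False
  then have n2: "n \<ge> 2" using n by simp
  have "norm f \<le> norm (f - (f \<bullet> e 1) *\<^sub>R e 1) + norm ((f \<bullet> e 1) *\<^sub>R e 1)"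
    using norm_triangle_ineq[of "f - (f \<bullet> e 1) *\<^sub>R e 1" "(f \<bullet> e 1) *\<^sub>R e 1"] by simp
  also have "norm (f - (f \<bullet> e 1) *\<^sub>R e 1) \<le> b 2 * norm f"
    using f[of 1] unfolding orth_proj_span[OF e] by (simp add: numeral_2_eq_2)
  also have "b 2 * norm f \<le> 1/2 * norm f" using b(1) by (intro mult_right_mono) auto
  also have "norm ((f \<bullet> e 1) *\<^sub>R e 1) = f \<bullet> e 1"
    using f1 orthonormal_basis_norm[OF e, of 1] by simp
  finally have big: "norm f / 2 \<le> f \<bullet> e 1" by simp
  \<comment> \<open>Projecting onto the first \<open>n - 1\<close> vectors removes nothing from the
    coefficient at \<open>n\<close>, and the decay condition at \<open>m = n - 1\<close> carries
    exactly the weight \<open>b n\<close>.\<close>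
  define p where "p = (\<Sum>i=1..n-1. (f \<bullet> e i) *\<^sub>R e i)"
  have "\<bar>f \<bullet> e n\<bar> = \<bar>(f - p) \<bullet> e n\<bar>"
    using inner_partial_sum[OF e n, of "\<lambda>i. f \<bullet> e i" "n - 1"] n by (simp add: inner_diff_left p_def)
  also have "\<dots> \<le> norm (f - p)"
    using Cauchy_Schwarz_ineq2[of "f - p" "e n"] orthonormal_basis_norm[OF e n] by simp
  also have "\<dots> \<le> b n * norm f"
    using f[of "n - 1"] n2 unfolding orth_proj_span[OF e] p_def by simp
  also have "\<dots> \<le> a n / 2 * norm f" using b(2)[OF n2] by (intro mult_right_mono) auto
  also have "\<dots> \<le> a n * (f \<bullet> e 1)" using mult_left_mono[OF big a[OF n2]] by simp
  finally show ?thesis using \<Phi>(2)[OF n2] by (simp add: inner_add_right)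
qed (use f1 \<Phi>(1) in simp)

theorem theorem3p1:
  fixes e \<Phi> :: "nat \<Rightarrow> 'a::{real_inner,complete_space}"
    and \<epsilon> :: real and \<alpha> \<beta> :: "nat \<Rightarrow> real" and B :: "'a set"
  assumes "\<not> (\<exists>S::'a set. finite S \<and> span S = UNIV)"
    and "orthonormal_basis e"
    and "0 < \<epsilon>" and "\<epsilon> < 1/8"
    and "antimono_on {1..} \<alpha>" and "\<alpha> \<longlonglongrightarrow> 0"
    and "\<alpha> summable_on {2..}" and "(\<Sum>\<^sub>\<infinity>n\<in>{2..}. \<alpha> n) < \<epsilon> / 2"
    and "antimono_on {1..} \<beta>" and "\<beta> \<longlonglongrightarrow> 0"
    and "\<And>n. n \<ge> 1 \<Longrightarrow> \<beta> n < \<alpha> n / 2"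
    and "B = {f. \<forall>m\<ge>1. norm (f - orth_proj (span (e ` {1..m})) f) \<le> \<beta> (m + 1) * norm f}"
    and "\<Phi> 1 = e 1" and "\<And>n. n \<ge> 2 \<Longrightarrow> \<Phi> n = \<alpha> n *\<^sub>R e 1 + e n"
  shows "riesz_basis \<Phi> \<and>
    (\<forall>f\<in>B. \<forall>g\<in>B.
      (INF a\<in>{a::real. \<bar>a\<bar> = 1}. norm (f - a *\<^sub>R g))
        \<le> (1 - \<epsilon>) powr (- 1/2) * ell2_norm (\<lambda>n. amplitude \<Phi> f n - amplitude \<Phi> g n))"
proof (intro conjI ballI)
  \<comment> \<open>From index \<open>n\<close> on, the sequence stays below
    \<open>\<alpha> n\<close>, hence so does its limit 0.\<close>
  have \<alpha>0: "0 \<le> \<alpha> n" if "n \<ge> 2" for n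
  proof (rule LIMSEQ_le_const2[OF \<open>\<alpha> \<longlonglongrightarrow> 0\<close>])
    show "\<exists>N. \<forall>k\<ge>N. \<alpha> k \<le> \<alpha> n"
      using that \<open>antimono_on {1..} \<alpha>\<close> by (intro exI[of _ n]) (auto simp: monotone_on_def)
  qed
  have \<alpha>2: "\<alpha> 2 \<le> \<epsilon> / 2"
    using finite_sum_le_infsum[OF \<open>\<alpha> summable_on {2..}\<close>, of "{2}"] \<alpha>0
      \<open>(\<Sum>\<^sub>\<infinity>n\<in>{2..}. \<alpha> n) < \<epsilon> / 2\<close> by auto
  have \<beta>2: "\<beta> 2 \<le> 1/2" using \<open>\<And>n. n \<ge> 1 \<Longrightarrow> \<beta> n < \<alpha> n / 2\<close>[of 2] \<alpha>2 \<open>\<epsilon> < 1/8\<close> by simp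
  note \<Phi> = \<open>\<Phi> 1 = e 1\<close> \<open>\<And>n. n \<ge> 2 \<Longrightarrow> \<Phi> n = \<alpha> n *\<^sub>R e 1 + e n\<close>
  note e = \<open>orthonormal_basis e\<close>
  show riesz: "riesz_basis \<Phi>"
    by (rule riesz_basis_perturbation[OF e \<alpha>0 \<open>\<alpha> summable_on {2..}\<close> \<Phi>])
  \<comment> \<open>One sign \<open>s\<close>, depending on \<open>f\<close> but not on
    \<open>n\<close>, removes all the absolute values. The decay condition passes to
    \<open>s *\<^sub>R f\<close> because the projections are linear.\<close>
  have sign: "\<exists>s. \<bar>s\<bar> = 1 \<and> (\<forall>n\<ge>1. \<bar>f \<bullet> \<Phi> n\<bar> = s * (f \<bullet> \<Phi> n))" if f: "f \<in> B" for f
  proof -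
    define s :: real where "s = (if f \<bullet> e 1 \<ge> 0 then 1 else -1)"
    have s: "\<bar>s\<bar> = 1" by (simp add: s_def)
    have "(s *\<^sub>R f) \<bullet> \<Phi> n \<ge> 0" if n: "n \<ge> 1" for n
    proof (rule inner_nonneg_of_decay[where b = \<beta> and a = \<alpha>, OF e _ \<beta>2 _ \<alpha>0 \<Phi> _ n])
      fix m :: nat assume "m \<ge> 1"
      then have "norm (f - orth_proj (span (e ` {1..m})) f) \<le> \<beta> (m + 1) * norm f"
        using f \<open>B = _\<close> by blast
      moreover have "s *\<^sub>R f - orth_proj (span (e ` {1..m})) (s *\<^sub>R f)
          = s *\<^sub>R (f - orth_proj (span (e ` {1..m})) f)"
        unfolding orth_proj_span[OF e] by (simp add: scaleR_diff_right scaleR_sum_right)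
      ultimately show "norm (s *\<^sub>R f - orth_proj (span (e ` {1..m})) (s *\<^sub>R f))
          \<le> \<beta> (m + 1) * norm (s *\<^sub>R f)"
        using s by simp
    next
      show "\<beta> k \<le> \<alpha> k / 2" if "k \<ge> 2" for k
        using \<open>\<And>n. n \<ge> 1 \<Longrightarrow> \<beta> n < \<alpha> n / 2\<close>[of k] that by simp
    qed (auto simp: s_def)
    then have "\<bar>f \<bullet> \<Phi> n\<bar> = s * (f \<bullet> \<Phi> n)" if "n \<ge> 1" for n
      using that s by (metis abs_mult abs_of_nonneg inner_scaleR_left mult_1)
    then show ?thesis using s by blast
  qed
  fix f g assume "f \<in> B" "g \<in> B"
  obtain s where s: "\<bar>s\<bar> = 1" "\<And>n. n \<ge> 1 \<Longrightarrow> \<bar>f \<bullet> \<Phi> n\<bar> = s * (f \<bullet> \<Phi> n)"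
    using sign[OF \<open>f \<in> B\<close>] by blast
  obtain t where t: "\<bar>t\<bar> = 1" "\<And>n. n \<ge> 1 \<Longrightarrow> \<bar>g \<bullet> \<Phi> n\<bar> = t * (g \<bullet> \<Phi> n)"
    using sign[OF \<open>g \<in> B\<close>] by blast
  define h where "h = s *\<^sub>R f - t *\<^sub>R g"
  let ?D = "\<lambda>n. amplitude \<Phi> f n - amplitude \<Phi> g n"
  have D: "?D n = h \<bullet> \<Phi> n" if "n \<ge> 1" for n
    using s(2)[OF that] t(2)[OF that] by (simp add: amplitude_def h_def inner_diff_left)
  \<comment> \<open>A divergent infinite sum would default to 0 and spoil the lower bound; square
    summability of the amplitudes, from the Riesz basis property, excludes this.\<close>
  have "?D \<in> ell2" by (intro ell2_diff amplitude_in_ell2 riesz)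
  then have "(\<lambda>n. (h \<bullet> \<Phi> n)\<^sup>2) summable_on {1..}"
    unfolding ell2_def mem_Collect_eq by (rule summable_on_cong[THEN iffD1, rotated]) (simp add: D)
  from riesz_lower_bound[OF e \<alpha>0 \<open>\<alpha> summable_on {2..}\<close> \<Phi> this]
  have "(1 - 2 * (\<Sum>\<^sub>\<infinity>n\<in>{2..}. \<alpha> n)) * (norm h)\<^sup>2 \<le> (\<Sum>\<^sub>\<infinity>n\<in>{1..}. (h \<bullet> \<Phi> n)\<^sup>2)" .
  moreover have "(1 - \<epsilon>) * (norm h)\<^sup>2 \<le> (1 - 2 * (\<Sum>\<^sub>\<infinity>n\<in>{2..}. \<alpha> n)) * (norm h)\<^sup>2"
    using \<open>(\<Sum>\<^sub>\<infinity>n\<in>{2..}. \<alpha> n) < \<epsilon> / 2\<close> by (intro mult_right_mono) auto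
  moreover have "(\<Sum>\<^sub>\<infinity>n\<in>{1..}. (h \<bullet> \<Phi> n)\<^sup>2) = (\<Sum>\<^sub>\<infinity>n\<in>{1..}. (?D n)\<^sup>2)"
    by (rule infsum_cong) (simp add: D)
  ultimately have "sqrt ((1 - \<epsilon>) * (norm h)\<^sup>2) \<le> ell2_norm ?D"
    unfolding ell2_norm_def by (intro real_sqrt_le_mono) linarith
  then have main: "sqrt (1 - \<epsilon>) * norm h \<le> ell2_norm ?D" by (simp add: real_sqrt_mult)
  have pos: "sqrt (1 - \<epsilon>) > 0" using \<open>\<epsilon> < 1/8\<close> by simp
  have "(1 - \<epsilon>) powr (- 1/2) = inverse (sqrt (1 - \<epsilon>))"
    using \<open>\<epsilon> < 1/8\<close> by (simp add: powr_minus powr_half_sqrt)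
  moreover have "norm h \<le> inverse (sqrt (1 - \<epsilon>)) * ell2_norm ?D"
    using main pos by (simp add: field_simps)
  ultimately have bound: "norm h \<le> (1 - \<epsilon>) powr (- 1/2) * ell2_norm ?D" by metis
  \<comment> \<open>Factoring the sign \<open>s\<close> out of \<open>h\<close> exhibits
    \<open>s * t\<close> as the admissible scalar at which the infimum is tested.\<close>
  have "s * s = 1" using s(1) by (metis abs_mult_self_eq mult_1)
  then have "h = s *\<^sub>R (f - (s * t) *\<^sub>R g)"
    by (simp add: h_def scaleR_diff_right mult.assoc[symmetric])
  then have h: "norm h = norm (f - (s * t) *\<^sub>R g)" using s(1) by simp
  have "(INF a\<in>{a::real. \<bar>a\<bar> = 1}. norm (f - a *\<^sub>R g)) \<le> norm (f - (s * t) *\<^sub>R g)"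
    by (rule cINF_lower) (use s(1) t(1) in \<open>auto intro!: bdd_belowI2[where m = 0] simp: abs_mult\<close>)
  then show "(INF a\<in>{a::real. \<bar>a\<bar> = 1}. norm (f - a *\<^sub>R g))
      \<le> (1 - \<epsilon>) powr (- 1/2) * ell2_norm ?D"
    using h bound by simp
qed

end
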